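(* Let $n\ge1$ be an integer. Consider the following two statements. (D) For every $\lambda\in(0,1)$, every real $p\ge1$ (with Hölder conjugate $q$), all non-empty bounded sets $K,L\subset\mathbb{R}^n$, every $\alpha$ with $-1/n\le\alpha\le\infty$ and all functions $f,g,h:\mathbb{R}^n\to\mathbb{R}_{\ge0}$ such that $$h\Bigl((1-\lambda)^{1/p}(1-\mu)^{1/q}x+\lambda^{1/p}\mu^{1/q}y\Bigr)\geq\Bigl[(1-\lambda)^{1/p}(1-\mu)^{1/q}f(x)^{\alpha}+\lambda^{1/p}\mu^{1/q}g(y)^{\alpha}\Bigr]^{1/\alpha}$$ for all $x\in K$, $y\in L$ with $f(x)g(y)>0$ and all $\mu\in[0,1]$, one has $$\sum_{z\in(M_p+(-1,1)^n)\cap\mathbb{Z}^n} h^{\diamond}(z)\geq\mathcal{M}_{\frac{p\alpha}{n\alpha+1}}^{\lambda}\left(\sum_{x\in K\cap\mathbb{Z}^n}f(x),\ \sum_{y\in L\cap\mathbb{Z}^n}g(y)\right),$$ where $M_p=(1-\lambda)\cdot K+_p\lambda\cdot L$. (C) For every $\lambda\in(0,1)$, every real $p\ge1$ (with Hölder conjugate $q$), every $\alpha$ with $-1/n\le\alpha\le\infty$ and all integrable functions $f,g,h:\mathbb{R}^n\to\mathbb{R}_{\ge0}$ such that $f$ and $g$ are Riemann integrable, $h$ is upper semicontinuous, and $$h\Bigl((1-\lambda)^{1/p}(1-\mu)^{1/q}x+\lambda^{1/p}\mu^{1/q}y\Bigr)\geq\Bigl[(1-\lambda)^{1/p}(1-\mu)^{1/q}f(x)^{\alpha}+\lambda^{1/p}\mu^{1/q}g(y)^{\alpha}\Bigr]^{1/\alpha}$$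 for all $x,y\in\mathbb{R}^n$ with $f(x)g(y)>0$ and all $\mu\in[0,1]$, one has $$\int_{\mathbb{R}^n}h(x)\,dx\geq\mathcal{M}_{\frac{p\alpha}{n\alpha+1}}^{\lambda}\left(\int_{\mathbb{R}^n}f(x)\,dx,\ \int_{\mathbb{R}^n}g(x)\,dx\right).$$ Then (D) implies (C).
   Context: Sets and $p$-sums. $+$ between sets is Minkowski addition, $A+B=\{a+b:a\in A,\ b\in B\}$, and $rA=\{ra:a\in A\}$ for $r\ge0$. For real $p\ge1$ the Hölder conjugate $q\in(1,\infty]$ satisfies $1/p+1/q=1$. For arbitrary $A,B\subset\mathbb{R}^n$, $$A+_pB=\bigl\{(1-\mu)^{1/q}x+\mu^{1/q}y:\ x\in A,\ y\in B,\ 0\le\mu\le1\bigr\}.$$ When $p=1$ (so $q=\infty$), the coefficients $(1-\mu)^{1/q}$ and $\mu^{1/q}$ are always understood to be $1$ for all $\mu\in[0,1]$ (here and in the hypotheses on $f,g,h$). Moreover $r\cdot A=r^{1/p}A$ for $r\ge0$, and $r\cdot A+_ps\cdot B$ means $(r\cdot A)+_p(s\cdot B)$. Means. For $a,b>0$ and $\lambda\in(0,1)$: $\mathcal{M}_\beta^\lambda(a,b)=((1-\lambda)a^\beta+\lambda b^\beta)^{1/\beta}$ for $\beta\in\mathbb{R}\setminus\{0\}$; $\mathcal{M}_0^\lambda(a,b)=a^{1-\lambda}b^\lambda$; $\mathcal{M}_\infty^\lambda(a,b)=\max\{a,b\}$; $\mathcal{M}_{-\infty}^\lambda(a,b)=\min\{a,b\}$.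 If $ab=0$ then $\mathcal{M}_\beta^\lambda(a,b)=0$ for all $\beta\in\mathbb{R}\cup\{\pm\infty\}$. The index $\frac{p\alpha}{n\alpha+1}$ is understood as $p/n$ when $\alpha=\infty$ and as $-\infty$ when $\alpha=-1/n$. Conventions for the hypotheses. For $\alpha=\infty$ the right-hand side $[t f(x)^\alpha+s g(y)^\alpha]^{1/\alpha}$ is understood as $\max\{f(x),g(y)\}$. For $\alpha=0$ the whole hypothesis on $f,g,h$ is understood as: $h((1-\lambda)x+\lambda y)\ge f(x)^{1-\lambda}g(y)^\lambda$ for all $x,y$ in the indicated ranges with $f(x)g(y)>0$. For $\phi:\mathbb{R}^n\to\mathbb{R}_{\ge0}$, $\phi^{\diamond}(z)=\sup_{u\in(-1,1)^n}\phi(z+u)$ for $z\in\mathbb{R}^n$ (the supremum taken in $[0,+\infty]$). "Integrable" means Lebesgue integrable on $\mathbb{R}^n$; "Riemann integrable" means Riemann integrable on every cube $[-k,k]^n$, $k\in\mathbb{N}$. *)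

theory Defs
  imports "HOL-Analysis.Analysis" "HOL-Library.Set_Algebras"
begin

section \<open>Hoelder conjugate and p-sums\<close>

definition holder_conj :: "real \<Rightarrow> ereal" where
  "holder_conj p = (if p = 1 then \<infinity> else ereal (p / (p - 1)))"

lemma holder_conj_iff:
  assumes "1 \<le> p"
  shows "q = holder_conj p \<longleftrightarrow> 1 < q \<and> 1 / ereal p + 1 / q = 1"
proof (cases q)
  case (real r)
  show ?thesis
  proof (cases "p = 1")
    case True
    then show ?thesis using real by (auto simp: holder_conj_def one_ereal_def)
  next
    case False
    have "r = p / (p - 1) \<longleftrightarrow> 1 < r \<and> 1 / p + 1 / r = 1"
    proof
      assume r: "r = p / (p - 1)"
      moreover have "p / (p - 1) = 1 + 1 / (p - 1)"
        using False by (simp add: field_simps)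
      ultimately have "1 < r" using assms False by simp
      moreover have "1 / p + 1 / r = 1"
        using r assms by (simp flip: add_divide_distrib)
      ultimately show "1 < r \<and> 1 / p + 1 / r = 1" by simp
    next
      assume r: "1 < r \<and> 1 / p + 1 / r = 1"
      then have "r \<noteq> 0" by simp
      have "p * r = p * r * (1 / p + 1 / r)" using r by simp
      also have "\<dots> = r + p"
        using assms \<open>r \<noteq> 0\<close> by (simp add: distrib_left)
      finally show "r = p / (p - 1)"
        using False by (simp add: eq_divide_eq algebra_simps)
    qed
    moreover have "q = holder_conj p \<longleftrightarrow> r = p / (p - 1)"
      using real False by (simp add: holder_conj_def)
    moreover have "1 < q \<and> 1 / ereal p + 1 / q = 1 \<longleftrightarrow> 1 < r \<and> 1 / p + 1 / r = 1"
      using real assms by (auto simp: one_ereal_def)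
    ultimately show ?thesis by simp
  qed
next
  case PInf
  then show ?thesis using assms by (auto simp: holder_conj_def one_ereal_def)
next
  case MInf
  then show ?thesis by (auto simp: holder_conj_def)
qed

text \<open>\<open>holder_pow p \<mu>\<close> stands for $\mu^{1/q}$ with $q$ conjugate to $p$. The case $q = \infty$ is
  separate because \<open>0 powr 0 = 0\<close>, whereas the coefficient is 1 for all $\mu$.\<close>

definition holder_pow :: "real \<Rightarrow> real \<Rightarrow> real" where
  "holder_pow p \<mu> =
     (if holder_conj p = \<infinity> then 1 else \<mu> powr (1 / real_of_ereal (holder_conj p)))"

definition p_sum :: "real \<Rightarrow> 'a::real_vector set \<Rightarrow> 'a set \<Rightarrow> 'a set" where
  "p_sum p A B = {holder_pow p (1 - \<mu>) *\<^sub>R x + holder_pow p \<mu> *\<^sub>R y | x y \<mu>.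
                    x \<in> A \<and> y \<in> B \<and> 0 \<le> \<mu> \<and> \<mu> \<le> 1}"

definition p_scale :: "real \<Rightarrow> real \<Rightarrow> 'a::real_vector set \<Rightarrow> 'a set" where
  "p_scale p r A = (\<lambda>x. r powr (1 / p) *\<^sub>R x) ` A"

definition p_combination :: "real \<Rightarrow> real \<Rightarrow> 'a::real_vector set \<Rightarrow> 'a set \<Rightarrow> 'a set" where
  "p_combination p l K L = p_sum p (p_scale p (1 - l) K) (p_scale p l L)"


section \<open>Means\<close>

definition power_mean :: "ereal \<Rightarrow> real \<Rightarrow> real \<Rightarrow> real \<Rightarrow> real" where
  "power_mean \<beta> l a b =
     (if a * b = 0 then 0
      else if \<beta> = \<infinity> then max a b
      else if \<beta> = -\<infinity> then min a b
      else if \<beta> = 0 then a powr (1 - l) * b powr l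
      else ((1 - l) * a powr real_of_ereal \<beta> + l * b powr real_of_ereal \<beta>)
             powr (1 / real_of_ereal \<beta>))"

text \<open>The index $p\alpha/(n\alpha+1)$.\<close>

definition mean_index :: "real \<Rightarrow> nat \<Rightarrow> ereal \<Rightarrow> ereal" where
  "mean_index p n \<alpha> =
     (if \<alpha> = \<infinity> then ereal (p / real n)
      else if \<alpha> = ereal (- 1 / real n) then -\<infinity>
      else ereal (p * real_of_ereal \<alpha> / (real n * real_of_ereal \<alpha> + 1)))"


section \<open>The hypothesis on three functions\<close>

text \<open>For $\alpha = 0$ the condition does not involve $p$ and $\mu$, so that case is separated at
  the level of the whole condition.\<close>

definition p_mean_condition ::
  "real \<Rightarrow> real \<Rightarrow> ereal \<Rightarrow> 'a::real_vector set \<Rightarrow> 'a set \<Rightarrow>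
     ('a \<Rightarrow> real) \<Rightarrow> ('a \<Rightarrow> real) \<Rightarrow> ('a \<Rightarrow> real) \<Rightarrow> bool" where
  "p_mean_condition l p \<alpha> K L f g h \<longleftrightarrow>
     (if \<alpha> = 0 then
        (\<forall>x\<in>K. \<forall>y\<in>L. f x * g y > 0 \<longrightarrow>
           h ((1 - l) *\<^sub>R x + l *\<^sub>R y) \<ge> f x powr (1 - l) * g y powr l)
      else
        (\<forall>x\<in>K. \<forall>y\<in>L. \<forall>\<mu>\<in>{0..1}. f x * g y > 0 \<longrightarrow>
           (let t = (1 - l) powr (1 / p) * holder_pow p (1 - \<mu>);
                s = l powr (1 / p) * holder_pow p \<mu>;
                a = real_of_ereal \<alpha>
            in h (t *\<^sub>R x + s *\<^sub>R y) \<ge>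
                 (if \<alpha> = \<infinity> then max (f x) (g y)
                  else (t * f x powr a + s * g y powr a) powr (1 / a)))))"


section \<open>Lattice points and the supremum over the open cube\<close>

definition int_lattice :: "(real^'n) set" where
  "int_lattice = {z. \<forall>i. z $ i \<in> \<int>}"

definition open_cube :: "(real^'n) set" where
  "open_cube = {u. \<forall>i. -1 < u $ i \<and> u $ i < 1}"

definition cube_sup :: "(real^'n \<Rightarrow> real) \<Rightarrow> real^'n \<Rightarrow> ennreal" where
  "cube_sup \<phi> z = (SUP u\<in>open_cube. ennreal (\<phi> (z + u)))"


section \<open>Riemann integrability and upper semicontinuity\<close>

text \<open>Convergence of Riemann sums as the mesh tends to 0. In contrast to \<open>integrable_on\<close>
  (the gauge integral), the mesh bound is uniform.\<close>

definition riemann_integrable_on :: "(real^'n \<Rightarrow> real) \<Rightarrow> (real^'n) set \<Rightarrow> bool" where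
  "riemann_integrable_on f S \<longleftrightarrow>
     (\<exists>I. \<forall>e>0. \<exists>d>0. \<forall>D. D tagged_division_of S \<and> (\<forall>(x, C)\<in>D. diameter C < d) \<longrightarrow>
        \<bar>(\<Sum>(x, C)\<in>D. measure lborel C * f x) - I\<bar> < e)"

definition riemann_integrable :: "(real^'n \<Rightarrow> real) \<Rightarrow> bool" where
  "riemann_integrable f \<longleftrightarrow>
     (\<forall>k::nat. riemann_integrable_on f (cbox (\<chi> i. - real k) (\<chi> i. real k)))"

definition upper_semicontinuous :: "('a::topological_space \<Rightarrow> real) \<Rightarrow> bool" where
  "upper_semicontinuous h \<longleftrightarrow> (\<forall>x. \<forall>c. h x < c \<longrightarrow> eventually (\<lambda>y. h y < c) (nhds x))"


section \<open>The lattice sums are finite sums\<close>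

lemma finite_int_lattice_Int:
  fixes S :: "(real^'n) set"
  assumes "bounded S"
  shows "finite (S \<inter> int_lattice)"
proof -
  obtain B where B: "\<And>x. x \<in> S \<Longrightarrow> norm x \<le> B"
    using assms by (auto simp: bounded_iff)
  let ?Z = "(of_int ` {- \<lceil>B\<rceil>..\<lceil>B\<rceil>}) :: real set"
  have "finite {z :: real^'n. \<forall>i. z $ i \<in> ?Z}"
  proof (rule finite_subset)
    show "{z :: real^'n. \<forall>i. z $ i \<in> ?Z} \<subseteq> vec_lambda ` (UNIV \<rightarrow>\<^sub>E ?Z)"
    proof
      fix z :: "real^'n" assume "z \<in> {z. \<forall>i. z $ i \<in> ?Z}"
      then have "vec_nth z \<in> UNIV \<rightarrow>\<^sub>E ?Z" by auto
      then show "z \<in> vec_lambda ` (UNIV \<rightarrow>\<^sub>E ?Z)" by (metis imageI vec_nth_inverse)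
    qed
    show "finite (vec_lambda ` (UNIV \<rightarrow>\<^sub>E ?Z) :: (real^'n) set)"
      by (intro finite_imageI finite_PiE) auto
  qed
  moreover have "S \<inter> int_lattice \<subseteq> {z. \<forall>i. z $ i \<in> ?Z}"
  proof (clarify)
    fix z :: "real^'n" and i assume z: "z \<in> S" "z \<in> int_lattice"
    then obtain m :: int where m: "z $ i = of_int m"
      by (auto simp: int_lattice_def elim: Ints_cases)
    have "\<bar>z $ i\<bar> \<le> B"
      using component_le_norm_cart[of z i] B[OF z(1)] by linarith
    then have "- \<lceil>B\<rceil> \<le> m" "m \<le> \<lceil>B\<rceil>"
      unfolding m by linarith+
    then show "z $ i \<in> ?Z" using m by auto
  qed
  ultimately show ?thesis by (rule finite_subset[rotated])
qed

lemma bounded_p_combination_open_cube: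
  fixes K L :: "(real^'n) set"
  assumes "1 \<le> p" "0 < l" "l < 1" "bounded K" "bounded L"
  shows "bounded (p_combination p l K L + open_cube)"
proof -
  obtain B where B: "B > 0" "\<And>x. x \<in> K \<Longrightarrow> norm x \<le> B" 
    using assms(4) by (auto simp: bounded_pos)
  obtain C where C: "C > 0" "\<And>x. x \<in> L \<Longrightarrow> norm x \<le> C" 
    using assms(5) by (auto simp: bounded_pos)
  have hp: "0 \<le> holder_pow p m \<and> holder_pow p m \<le> 1" if "0 \<le> m" "m \<le> 1" for m
    using that assms(1) by (auto simp: holder_pow_def holder_conj_def powr_le1)
  have lp: "r powr (1 / p) \<le> 1" if "0 \<le> r" "r \<le> 1" for r
    using that assms(1) by (simp add: powr_le1)
  have bound: "norm (a *\<^sub>R b *\<^sub>R x) \<le> N"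
    if "0 \<le> a \<and> a \<le> 1" "0 \<le> b" "b \<le> 1" "norm x \<le> N" for a b N and x :: "real^'n"
  proof -
    have "norm (a *\<^sub>R b *\<^sub>R x) = (a * b) * norm x" using that by (simp add: abs_mult)
    also have "\<dots> \<le> 1 * norm x"
      using that by (intro mult_right_mono mult_le_one) auto
    finally show ?thesis using that by simp
  qed
  have "norm v \<le> B + C" if v: "v \<in> p_combination p l K L" for v
  proof -
    obtain x y m where xy: "x \<in> K" "y \<in> L" "0 \<le> m" "m \<le> 1" and
      v: "v = holder_pow p (1 - m) *\<^sub>R ((1 - l) powr (1 / p) *\<^sub>R x) +
              holder_pow p m *\<^sub>R (l powr (1 / p) *\<^sub>R y)"
      using v unfolding p_combination_def p_sum_def p_scale_def by blast
    show ?thesis unfolding v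
      by (intro norm_triangle_le add_mono bound hp lp B C xy) (use assms xy in auto)
  qed
  then have "bounded (p_combination p l K L)" by (auto simp: bounded_iff)
  moreover have "bounded (open_cube :: (real^'n) set)"
  proof -
    have "(open_cube :: (real^'n) set) \<subseteq> cbox (\<chi> i. -1) (\<chi> i. 1)"
      by (auto simp: open_cube_def mem_box_cart less_imp_le)
    then show ?thesis using bounded_cbox bounded_subset by blast
  qed
  ultimately have "bounded (\<Union>x\<in>p_combination p l K L. \<Union>y\<in>open_cube. {x + y})"
    by (rule bounded_sums)
  then show ?thesis by (rule bounded_subset) (auto simp: set_plus_def)
qed

end

theory Submission
  imports Defs
begin

text \<open>
  The lattice inequality becomes the integral inequality by refining the lattice. The hypothesis
  evaluates \<open>h\<close> at linear combinations of \<open>x\<close> and \<open>y\<close>, so it survives the substitution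
  \<open>x \<mapsto> x / m\<close> (\<open>p_mean_condition_rescale\<close>). Apply the discrete inequality to the three dilated
  functions with \<open>K\<close> and \<open>L\<close> both equal to the cube \<open>[-mk, mk)\<close> to the power \<open>n\<close>, and divide by
  \<open>m\<close> to the power \<open>n\<close>; the power mean is homogeneous of degree one, so this factor passes
  inside it.

  As \<open>m\<close> tends to infinity, the arguments of the mean are Riemann sums of \<open>f\<close> and \<open>g\<close> over the
  cube \<open>[-k, k]\<close> to the power \<open>n\<close>, with the lower corners of the cells as tags; they tend to
  the integrals over that cube (\<open>lattice_riemann_sums\<close>), because the Riemann integral and the
  Lebesgue integral agree. On the other side stands the integral of a step function whose value on
  a cell of side \<open>1 / m\<close> is the supremum of \<open>h\<close> over a neighbourhood of that cell of width
  comparable to \<open>1 / m\<close>. The limit superior of these step functions is at most \<open>h\<close> at each point,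
  by upper semicontinuity. For fixed \<open>k\<close> they vanish outside one compact set, on which upper
  semicontinuity also bounds them uniformly, and the reverse Fatou lemma bounds the limit superior
  of their integrals by the integral of \<open>h\<close> (\<open>limsup_lattice_sums_le_integral\<close>). So the integral
  of \<open>h\<close> dominates the mean of the integrals of \<open>f\<close> and \<open>g\<close> over every such cube, and \<open>k\<close>
  tending to infinity gives the claim by continuity of the mean at pairs of positive numbers. If
  one of the integrals of \<open>f\<close> and \<open>g\<close> vanishes, so does the mean, and the claim is trivial.
\<close>

section \<open>Cells of the lattice grid\<close>

text \<open>Half-open, so that for integral \<open>r\<close> the lattice points of the cube correspond exactly to the
  unit cells that tile its closure, each cell represented by its lower corner.\<close>

definition half_open_cube :: "real \<Rightarrow> (real^'n) set" where
  "half_open_cube r = {x. \<forall>i. - r \<le> x $ i \<and> x $ i < r}"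

abbreviation grid_cell :: "nat \<Rightarrow> real^'n \<Rightarrow> (real^'n) set" where
  "grid_cell m z \<equiv> cbox ((1 / real m) *\<^sub>R z) ((1 / real m) *\<^sub>R (z + 1))"

abbreviation open_grid_cell :: "nat \<Rightarrow> real^'n \<Rightarrow> (real^'n) set" where
  "open_grid_cell m z \<equiv> box ((1 / real m) *\<^sub>R z) ((1 / real m) *\<^sub>R (z + 1))"

lemma mem_grid_cell:
  assumes "0 < m"
  shows "x \<in> grid_cell m z \<longleftrightarrow> (\<forall>i. z $ i \<le> real m * x $ i \<and> real m * x $ i \<le> z $ i + 1)"
    and "x \<in> open_grid_cell m z \<longleftrightarrow> (\<forall>i. z $ i < real m * x $ i \<and> real m * x $ i < z $ i + 1)"
  using assms by (simp_all add: mem_box_cart field_simps)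

text \<open>The coordinatewise floor recovers the corner of an open cell from any of its points. This gives
  the disjointness of distinct open cells.\<close>

lemma open_grid_cell_unique:
  assumes "0 < m" "z \<in> int_lattice" "x \<in> open_grid_cell m z"
  shows "z = (\<chi> i. of_int \<lfloor>real m * x $ i\<rfloor>)"
proof -
  have "of_int \<lfloor>real m * x $ i\<rfloor> = z $ i" for i
  proof -
    obtain j where j: "z $ i = of_int j"
      using assms(2) by (auto simp: int_lattice_def elim: Ints_cases)
    have "\<lfloor>real m * x $ i\<rfloor> = j"
      using assms(3) j unfolding mem_grid_cell(2)[OF assms(1)]
      by (intro floor_unique) (auto simp: less_imp_le dest: spec[of _ i])
    then show ?thesis by (simp add: j)
  qed
  then show ?thesis by (simp add: vec_eq_iff)
qed

lemma grid_cell_corner_mem: "0 < m \<Longrightarrow> (1 / real m) *\<^sub>R z \<in> grid_cell m z"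
  by (simp add: mem_grid_cell)

lemma content_grid_cell:
  assumes "0 < m"
  shows "measure lborel (grid_cell m (z :: real^'n)) = (1 / real m) ^ CARD('n)"
proof -
  have "grid_cell m z \<noteq> {}"
    using grid_cell_corner_mem[OF assms] by blast
  then show ?thesis
    by (simp add: content_cbox_cart diff_divide_distrib[symmetric] power_one_over)
qed

lemma emeasure_open_grid_cell:
  assumes "0 < m"
  shows "emeasure lebesgue (open_grid_cell m (z :: real^'n)) = ennreal ((1 / real m) ^ CARD('n))"
proof -
  have "emeasure lebesgue (open_grid_cell m z) = emeasure lborel (grid_cell m z)"
    by (simp add: emeasure_lborel_box_eq emeasure_lborel_cbox_eq)
  also have "\<dots> = ennreal (measure lborel (grid_cell m z))"
    by (rule emeasure_eq_ennreal_measure) (simp add: emeasure_lborel_cbox_eq)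
  finally show ?thesis by (simp only: content_grid_cell[OF assms])
qed

lemma diameter_grid_cell:
  assumes "0 < m"
  shows "diameter (grid_cell m (z :: real^'n)) = norm (1 :: real^'n) / real m"
proof -
  have "diameter (grid_cell m z) = dist ((1 / real m) *\<^sub>R z) ((1 / real m) *\<^sub>R (z + 1))"
    using assms
    by (intro diameter_cbox) (auto simp: inner_add_left Basis_vec_def inner_axis divide_right_mono)
  also have "\<dots> = norm ((1 / real m) *\<^sub>R (1 :: real^'n))"
    by (simp add: dist_norm scaleR_add_right)
  finally show ?thesis by simp
qed

lemma finite_half_open_cube_lattice: "finite (half_open_cube r \<inter> int_lattice)"
proof (rule finite_int_lattice_Int)
  have "half_open_cube r \<subseteq> cbox (\<chi> i. - r) (\<chi> i. r)"
    by (auto simp: half_open_cube_def mem_box_cart less_imp_le)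
  then show "bounded (half_open_cube r)"
    using bounded_cbox bounded_subset by blast
qed

lemma grid_tagged_division:
  assumes m: "0 < m" and k: "0 < k"
  shows "(\<lambda>z. ((1 / real m) *\<^sub>R z, grid_cell m z)) `
           (half_open_cube (real m * real k) \<inter> int_lattice)
         tagged_division_of cbox (\<chi> i. - real k) (\<chi> i. real k :: real^'n)"
    (is "?D tagged_division_of ?B")
proof (rule tagged_division_ofI)
  show "finite ?D"
    by (intro finite_imageI finite_half_open_cube_lattice)
  show "x \<in> K" "\<exists>a b. K = cbox a b" if "(x, K) \<in> ?D" for x K
    using that grid_cell_corner_mem[OF m] by auto
  show sub: "K \<subseteq> ?B" if xK: "(x, K) \<in> ?D" for x K
  proof
    fix y assume "y \<in> K"
    then obtain z where z: "z \<in> half_open_cube (real m * real k)" "z \<in> int_lattice"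
        "y \<in> grid_cell m z"
      using xK by auto
    have "- real k \<le> y $ i \<and> y $ i \<le> real k" for i
    proof -
      obtain j where j: "z $ i = of_int j"
        using z(2) by (auto simp: int_lattice_def elim: Ints_cases)
      have b: "- (real m * real k) \<le> of_int j" "of_int j < real m * real k"
        using z(1) j by (auto simp: half_open_cube_def dest: spec[of _ i])
      \<comment> \<open>Integrality turns the strict upper bound on the corner into one for the whole cell.\<close>
      have "of_int j < (of_int (int m * int k) :: real)" using b(2) by simp
      then have "j + 1 \<le> int m * int k" by linarith
      then have "of_int (j + 1) \<le> (of_int (int m * int k) :: real)" by (rule of_int_le_iff[THEN iffD2])
      then have "real m * y $ i \<le> real m * real k" "real m * (- real k) \<le> real m * y $ i"
        using b(1) z(3) j unfolding mem_grid_cell(1)[OF m] by (auto dest!: spec[of _ i])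
      then show ?thesis using m by (simp only: mult_le_cancel_left_pos of_nat_0_less_iff)
    qed
    then show "y \<in> ?B" by (simp add: mem_box_cart)
  qed
  show "interior K1 \<inter> interior K2 = {}"
    if D: "(x1, K1) \<in> ?D" "(x2, K2) \<in> ?D" and ne: "(x1, K1) \<noteq> (x2, K2)" for x1 K1 x2 K2
  proof (rule ccontr)
    assume "interior K1 \<inter> interior K2 \<noteq> {}"
    then obtain y where y: "y \<in> interior K1" "y \<in> interior K2" by blast
    obtain z1 where z1: "z1 \<in> int_lattice" "x1 = (1 / real m) *\<^sub>R z1" "K1 = grid_cell m z1"
      using D(1) by blast
    obtain z2 where z2: "z2 \<in> int_lattice" "x2 = (1 / real m) *\<^sub>R z2" "K2 = grid_cell m z2"
      using D(2) by blast
    have "z1 = z2"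
      using open_grid_cell_unique[OF m z1(1)] open_grid_cell_unique[OF m z2(1)] y z1(3) z2(3)
      by (metis interior_cbox)
    then show False using ne z1 z2 by simp
  qed
  show "\<Union> {K. \<exists>x. (x, K) \<in> ?D} = ?B"
  proof
    show "\<Union> {K. \<exists>x. (x, K) \<in> ?D} \<subseteq> ?B" using sub by blast
    show "?B \<subseteq> \<Union> {K. \<exists>x. (x, K) \<in> ?D}"
    proof
      fix y assume y: "y \<in> ?B"
      \<comment> \<open>The minimum puts the points of the upper faces of the cube into the last cells.\<close>
      define z :: "real^'n" where "z = (\<chi> i. of_int (min \<lfloor>real m * y $ i\<rfloor> (int m * int k - 1)))"
      have "- (real m * real k) \<le> z $ i \<and> z $ i < real m * real k \<and>
            z $ i \<le> real m * y $ i \<and> real m * y $ i \<le> z $ i + 1" for i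
      proof -
        have "- real k \<le> y $ i" "y $ i \<le> real k"
          using y by (auto simp: mem_box_cart)
        then have "real m * (- real k) \<le> real m * y $ i" "real m * y $ i \<le> real m * real k"
          by (simp_all only: mult_left_mono of_nat_0_le_iff)
        then have b: "of_int (- (int m * int k)) \<le> real m * y $ i"
            "real m * y $ i \<le> of_int (int m * int k)"
          by auto
        have pos: "0 < int m * int k" using m k by simp
        define t where "t = min \<lfloor>real m * y $ i\<rfloor> (int m * int k - 1)"
        have "- (int m * int k) \<le> t" "t \<le> int m * int k - 1"
          using b(1) pos unfolding t_def le_floor_iff[symmetric] by auto
        moreover have "of_int t \<le> real m * y $ i"
          unfolding t_def by linarith
        moreover have "real m * y $ i \<le> of_int t + 1"
        proof (cases "\<lfloor>real m * y $ i\<rfloor> \<le> int m * int k - 1")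
          case True
          then show ?thesis unfolding t_def by linarith
        next
          case False
          then have "t = int m * int k - 1" unfolding t_def by simp
          then show ?thesis using b(2) by simp
        qed
        ultimately have "of_int (- (int m * int k)) \<le> (of_int t :: real)"
            "of_int t < (of_int (int m * int k) :: real)"
            "of_int t \<le> real m * y $ i" "real m * y $ i \<le> of_int t + 1"
          by (auto simp only: of_int_le_iff of_int_less_iff)
        then show ?thesis unfolding z_def t_def by simp
      qed
      then have "z \<in> half_open_cube (real m * real k) \<inter> int_lattice" "y \<in> grid_cell m z"
        unfolding mem_grid_cell(1)[OF m]
        by (simp_all add: half_open_cube_def int_lattice_def) (simp add: z_def)
      then show "y \<in> \<Union> {K. \<exists>x. (x, K) \<in> ?D}" by blast
    qed
  qed
qed

section \<open>Riemann sums over the lattice\<close>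

lemma fine_mesh_tagged_division:
  fixes a b :: "real^'n"
  assumes "gauge \<gamma>" "0 < d"
  obtains D where "D tagged_division_of cbox a b" "\<gamma> fine D" "\<forall>(x, C)\<in>D. diameter C < d"
proof -
  have "gauge (\<lambda>x. \<gamma> x \<inter> ball x (d / 3))"
    using assms by (intro gauge_Int gauge_ball) auto
  then obtain D where D: "D tagged_division_of cbox a b" "(\<lambda>x. \<gamma> x \<inter> ball x (d / 3)) fine D"
    by (rule fine_division_exists)
  have "diameter C < d" if "(x, C) \<in> D" for x C
  proof -
    have "C \<subseteq> ball x (d / 3)" using D(2) that by (auto simp: fine_def)
    \<comment> \<open>A ball of radius \<open>d / 3\<close> has diameter \<open>2 * d / 3\<close>, which is less than \<open>d\<close>.\<close>
    then have "diameter C \<le> diameter (ball x (d / 3))"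
      by (intro diameter_subset bounded_ball)
    then show ?thesis using \<open>0 < d\<close> by simp
  qed
  moreover have "\<gamma> fine D" using D(2) by (auto simp: fine_def)
  ultimately show ?thesis using that D(1) by blast
qed

text \<open>Cousin's lemma provides a tagged division that is both fine for a given gauge and of small mesh.
  One Riemann sum is therefore close to the Riemann integral and to the gauge integral.\<close>

lemma mesh_limit_eq_integral:
  fixes f :: "real^'n \<Rightarrow> real" and I J :: real
  assumes f: "(f has_integral J) (cbox a b)"
    and I: "\<forall>e>0. \<exists>d>0. \<forall>D. D tagged_division_of cbox a b \<and> (\<forall>(x, C)\<in>D. diameter C < d) \<longrightarrow>
              \<bar>(\<Sum>(x, C)\<in>D. measure lborel C * f x) - I\<bar> < e"
  shows "I = J"
proof (rule ccontr)
  assume "I \<noteq> J"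
  then have e: "0 < \<bar>I - J\<bar> / 2" by simp
  obtain d where d: "d > 0"
    "\<And>D. D tagged_division_of cbox a b \<Longrightarrow> (\<forall>(x, C)\<in>D. diameter C < d) \<Longrightarrow>
        \<bar>(\<Sum>(x, C)\<in>D. measure lborel C * f x) - I\<bar> < \<bar>I - J\<bar> / 2"
    using I e by meson
  obtain \<gamma> where g: "gauge \<gamma>"
    "\<And>D. D tagged_division_of cbox a b \<Longrightarrow> \<gamma> fine D \<Longrightarrow>
        norm ((\<Sum>(x, C)\<in>D. measure lborel C *\<^sub>R f x) - J) < \<bar>I - J\<bar> / 2"
    using f e unfolding has_integral by meson
  obtain D where D: "D tagged_division_of cbox a b" "\<gamma> fine D" "\<forall>(x, C)\<in>D. diameter C < d"
    using fine_mesh_tagged_division[OF g(1) d(1)] .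
  have "\<not> (\<bar>s - I\<bar> < \<bar>I - J\<bar> / 2 \<and> \<bar>s - J\<bar> < \<bar>I - J\<bar> / 2)" for s :: real
    by (smt (verit) field_sum_of_halves)
  then show False
    using d(2)[OF D(1,3)] g(2)[OF D(1,2)] by (simp only: real_norm_def real_scaleR_def) blast
qed

text \<open>The scaled lattice sum is the Riemann sum of the grid division tagged by lower corners, whose
  mesh tends to zero.\<close>

lemma lattice_riemann_sums:
  fixes f :: "real^'n \<Rightarrow> real"
  assumes R: "riemann_integrable f" and f: "integrable lebesgue f" and k: "0 < k"
  shows "(\<lambda>m. (1 / real m) ^ CARD('n) *
             (\<Sum>z\<in>half_open_cube (real m * real k) \<inter> int_lattice. f ((1 / real m) *\<^sub>R z)))
         \<longlonglongrightarrow> (\<integral>x. indicator (cbox (\<chi> i. - real k) (\<chi> i. real k)) x * f x \<partial>lebesgue)"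
    (is "?S \<longlonglongrightarrow> integral\<^sup>L _ (\<lambda>x. indicator ?B x * f x)")
proof -
  define J where "J = (\<integral>x. indicator ?B x * f x \<partial>lebesgue)"
  have "integrable lebesgue (\<lambda>x. indicator ?B x * f x)"
    using integrable_mult_indicator[OF _ f, of ?B] by simp
  then have "((\<lambda>x. indicator ?B x * f x) has_integral J) UNIV"
    unfolding J_def by (rule has_integral_integral_lebesgue)
  moreover have "(\<lambda>x. indicator ?B x * f x) = (\<lambda>x. if x \<in> ?B then f x else 0)"
    by (auto simp: indicator_def)
  ultimately have J: "(f has_integral J) ?B"
    by (simp only: has_integral_restrict_UNIV)
  obtain I where I: "\<forall>e>0. \<exists>d>0. \<forall>D. D tagged_division_of ?B \<and> (\<forall>(x, C)\<in>D. diameter C < d) \<longrightarrow>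
      \<bar>(\<Sum>(x, C)\<in>D. measure lborel C * f x) - I\<bar> < e"
    using R unfolding riemann_integrable_def riemann_integrable_on_def by blast
  have "I = J" by (rule mesh_limit_eq_integral[OF J I])
  have "?S \<longlonglongrightarrow> J"
  proof (rule LIMSEQ_I)
    fix e :: real assume "0 < e"
    then obtain d where d: "d > 0" "\<And>D. D tagged_division_of ?B \<Longrightarrow>
        (\<forall>(x, C)\<in>D. diameter C < d) \<Longrightarrow> \<bar>(\<Sum>(x, C)\<in>D. measure lborel C * f x) - J\<bar> < e"
      using I \<open>I = J\<close> by meson
    have "(\<lambda>m. norm (1 :: real^'n) / real m) \<longlonglongrightarrow> 0"
      by (rule lim_const_over_n)
    then have "eventually (\<lambda>m. norm (1 :: real^'n) / real m < d) sequentially"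
      using d(1) by (rule order_tendstoD)
    then obtain N where N: "\<And>m. N \<le> m \<Longrightarrow> norm (1 :: real^'n) / real m < d"
      by (auto simp: eventually_sequentially)
    have "norm (?S m - J) < e" if "Suc N \<le> m" for m
    proof -
      have m: "0 < m" "norm (1 :: real^'n) / real m < d" using that N by auto
      let ?Z = "half_open_cube (real m * real k) \<inter> int_lattice :: (real^'n) set"
      let ?t = "\<lambda>z :: real^'n. ((1 / real m) *\<^sub>R z, grid_cell m z)"
      have inj: "inj_on ?t ?Z"
        using m by (auto intro!: inj_onI)
      have "(\<Sum>(x, C)\<in>?t ` ?Z. measure lborel C * f x) = ?S m"
        unfolding sum.reindex[OF inj] sum_distrib_left
        by (rule sum.cong) (simp_all only: o_def prod.case content_grid_cell[OF m(1)])
      moreover have "\<forall>(x, C)\<in>?t ` ?Z. diameter C < d"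
        using m(2) by (auto simp only: diameter_grid_cell[OF m(1)] prod.case)
      ultimately show ?thesis
        using d(2)[OF grid_tagged_division[OF m(1) k]] by simp
    qed
    then show "\<exists>N. \<forall>m\<ge>N. norm (?S m - J) < e" by blast
  qed
  then show ?thesis unfolding J_def .
qed

lemma integral_cubes_tendsto:
  fixes f :: "real^'n \<Rightarrow> real"
  assumes f: "integrable lebesgue f"
  shows "(\<lambda>k. \<integral>x. indicator (cbox (\<chi> i. - real k) (\<chi> i. real k)) x * f x \<partial>lebesgue)
           \<longlonglongrightarrow> (\<integral>x. f x \<partial>lebesgue)"
proof (rule integral_dominated_convergence)
  show "f \<in> borel_measurable lebesgue" using f by simp
  show "integrable lebesgue (\<lambda>x. norm (f x))" using f by simp
  show "(\<lambda>x. indicator (cbox (\<chi> i. - real k) (\<chi> i. real k)) x * f x) \<in> borel_measurable lebesgue" for k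
    using f by (intro borel_measurable_times borel_measurable_indicator) auto
  show "AE x in lebesgue. norm (indicator (cbox (\<chi> i. - real k) (\<chi> i. real k)) x * f x) \<le> norm (f x)" for k
    by (intro AE_I2) (simp add: indicator_def)
  show "AE x in lebesgue. (\<lambda>k. indicator (cbox (\<chi> i. - real k) (\<chi> i. real k)) x * f x) \<longlonglongrightarrow> f x"
  proof (intro AE_I2 tendsto_eventually)
    fix x :: "real^'n"
    obtain N where N: "norm x \<le> real N" using real_arch_simple by blast
    have "indicator (cbox (\<chi> i. - real k) (\<chi> i. real k)) x * f x = f x" if "N \<le> k" for k
    proof -
      have "- real k \<le> x $ i \<and> x $ i \<le> real k" for i
        using component_le_norm_cart[of x i] N that by linarith
      then have "x \<in> cbox (\<chi> i. - real k) (\<chi> i. real k)"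
        by (simp add: mem_box_cart)
      then show ?thesis by simp
    qed
    then show "eventually (\<lambda>k. indicator (cbox (\<chi> i. - real k) (\<chi> i. real k)) x * f x = f x) sequentially"
      unfolding eventually_sequentially by blast
  qed
qed

section \<open>Lattice sums of an upper semicontinuous function\<close>

text \<open>The strict sublevel sets at the natural numbers form an open cover.\<close>

lemma upper_semicontinuous_bounded_above_on_compact:
  assumes h: "upper_semicontinuous h" and S: "compact S"
  obtains B where "\<And>x. x \<in> S \<Longrightarrow> h x \<le> B" "0 \<le> B"
proof -
  have op: "open {x. h x < real n}" for n :: nat
  proof (subst open_subopen, intro ballI)
    fix x assume "x \<in> {x. h x < real n}"
    then have "eventually (\<lambda>y. h y < real n) (nhds x)"
      using h by (simp add: upper_semicontinuous_def)
    then show "\<exists>T. open T \<and> x \<in> T \<and> T \<subseteq> {x. h x < real n}"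
      by (auto simp: eventually_nhds)
  qed
  have cover: "S \<subseteq> (\<Union>n. {x. h x < real n})"
    using reals_Archimedean2 by blast
  obtain N where N: "finite N" "S \<subseteq> (\<Union>n\<in>N. {x. h x < real n})"
    using compactE_image[OF S _ cover] op by metis
  \<comment> \<open>The sum serves as an upper bound of the finite set that also makes sense if it is empty.\<close>
  have "h x \<le> real (\<Sum>N)" if x: "x \<in> S" for x
  proof -
    obtain n where n: "n \<in> N" "h x < real n" using N(2) x by blast
    moreover have "n \<le> \<Sum>N" using member_le_sum[OF n(1), of "\<lambda>x. x"] N(1) by simp
    ultimately show ?thesis by linarith
  qed
  then show ?thesis by (rule that) (simp_all add: sum_nonneg)
qed

lemma near_of_common_cell:
  fixes x z u :: "real^'n"
  assumes m: "0 < m" and x: "x \<in> open_grid_cell m z" and u: "u \<in> open_cube"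
  shows "\<bar>((1 / real m) *\<^sub>R (z + u)) $ i - x $ i\<bar> \<le> 2 / real m"
proof -
  have "z $ i < real m * x $ i" "real m * x $ i < z $ i + 1" "-1 < u $ i" "u $ i < 1"
    using x u unfolding mem_grid_cell(2)[OF m] open_cube_def by auto
  then have "\<bar>z $ i + u $ i - real m * x $ i\<bar> \<le> 2" by linarith
  moreover have "((1 / real m) *\<^sub>R (z + u)) $ i - x $ i = (z $ i + u $ i - real m * x $ i) / real m"
    using m by (simp add: field_simps)
  ultimately show ?thesis using m by (simp add: divide_right_mono)
qed

text \<open>The scaled sum is the integral of a step function on the open cells; the cell boundaries form a
  null set, so leaving them out costs nothing. The bound on the coordinates of \<open>Z m\<close> confines the
  cells, and the points at which \<open>h\<close> enters the suprema, to one cube independent of \<open>m\<close>, as the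
  reverse Fatou lemma requires.\<close>

lemma limsup_lattice_sums_le_integral:
  fixes h :: "real^'n \<Rightarrow> real"
  assumes usc: "upper_semicontinuous h" and Z: "\<And>m. Z m \<subseteq> int_lattice" "\<And>m. finite (Z m)"
    and R: "\<And>m z i. 0 < m \<Longrightarrow> z \<in> Z m \<Longrightarrow> \<bar>z $ i\<bar> \<le> real m * R - 1"
  shows "limsup (\<lambda>m. ennreal ((1 / real m) ^ CARD('n)) *
             (\<Sum>z\<in>Z m. cube_sup (\<lambda>x. h ((1 / real m) *\<^sub>R x)) z))
         \<le> (\<integral>\<^sup>+x. ennreal (h x) \<partial>lebesgue)"
proof -
  define c where "c m z = cube_sup (\<lambda>x. h ((1 / real m) *\<^sub>R x)) z" for m z
  define Q :: "(real^'n) set" where "Q = cbox (\<chi> i. - R) (\<chi> i. R)"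
  obtain B where B: "\<And>x. x \<in> Q \<Longrightarrow> h x \<le> B" "0 \<le> B"
    using upper_semicontinuous_bounded_above_on_compact[OF usc, of Q] unfolding Q_def by auto
  \<comment> \<open>With \<open>1 / 0 = 0\<close>, the scaled sum is 0 for \<open>m = 0\<close>, and so is the step function.\<close>
  define H where "H m x = (if m = 0 then 0 else \<Sum>z\<in>Z m. c m z * indicator (open_grid_cell m z) x)"
    for m x
  \<comment> \<open>By disjointness of the open cells at most one summand is nonzero.\<close>
  have H_eq: "\<exists>z\<in>Z m. x \<in> open_grid_cell m z \<and> H m x = c m z" if "0 < m" "H m x \<noteq> 0" for m x
  proof -
    have "(\<Sum>z\<in>Z m. c m z * indicator (open_grid_cell m z) x) \<noteq> 0"
      using that by (simp add: H_def)
    then obtain z where z: "z \<in> Z m" "c m z * indicator (open_grid_cell m z) x \<noteq> 0"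
      by (rule sum.not_neutral_contains_not_neutral)
    then have x: "x \<in> open_grid_cell m z" by (auto simp: indicator_def split: if_splits)
    have "x \<notin> open_grid_cell m z'" if "z' \<in> Z m - {z}" for z'
      using open_grid_cell_unique[OF \<open>0 < m\<close>, of _ x] x z(1) that Z(1) by blast
    then have "H m x = c m z * indicator (open_grid_cell m z) x"
      using \<open>0 < m\<close> unfolding H_def
      by (simp add: sum.remove[OF Z(2) z(1)] sum.neutral)
    then show ?thesis using z(1) x by auto
  qed
  have H_meas: "H m \<in> borel_measurable lebesgue" for m
    unfolding H_def by (cases "m = 0")
      (auto intro!: borel_measurable_sum borel_measurable_times_ennreal borel_measurable_indicator)
  have H_int: "(\<integral>\<^sup>+x. H m x \<partial>lebesgue) = ennreal ((1 / real m) ^ CARD('n)) * (\<Sum>z\<in>Z m. c m z)" for m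
  proof (cases "m = 0")
    case True
    then show ?thesis by (simp add: H_def)
  next
    case False
    then have "(\<integral>\<^sup>+x. H m x \<partial>lebesgue)
        = (\<Sum>z\<in>Z m. \<integral>\<^sup>+x. c m z * indicator (open_grid_cell m z) x \<partial>lebesgue)"
      unfolding H_def
      by (auto intro!: nn_integral_sum borel_measurable_times_ennreal borel_measurable_indicator)
    also have "\<dots> = (\<Sum>z\<in>Z m. c m z * ennreal ((1 / real m) ^ CARD('n)))"
    proof (intro sum.cong refl)
      fix z
      have "(\<integral>\<^sup>+x. c m z * indicator (open_grid_cell m z) x \<partial>lebesgue)
          = c m z * emeasure lebesgue (open_grid_cell m z)"
        by (rule nn_integral_cmult_indicator) simp
      then show "(\<integral>\<^sup>+x. c m z * indicator (open_grid_cell m z) x \<partial>lebesgue)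
          = c m z * ennreal ((1 / real m) ^ CARD('n))"
        using False by (simp only: emeasure_open_grid_cell)
    qed
    finally show ?thesis by (simp only: sum_distrib_right mult.commute[of "ennreal _"])
  qed
  have H_bound: "H m x \<le> ennreal B * indicator Q x" for m x
  proof (cases "m = 0 \<or> H m x = 0")
    case True
    then show ?thesis by (auto simp: H_def)
  next
    case False
    then have m: "0 < m" by simp
    obtain z where z: "z \<in> Z m" "x \<in> open_grid_cell m z" "H m x = c m z"
      using H_eq False m by blast
    have zi: "\<bar>z $ i\<bar> \<le> real m * R - 1" for i using R[OF m z(1)] .
    have inQ: "v \<in> Q" if "\<And>i. \<bar>real m * v $ i\<bar> \<le> real m * R" for v :: "real^'n"
    proof -
      have "- R \<le> v $ i \<and> v $ i \<le> R" for i
      proof -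
        have "\<bar>v $ i\<bar> \<le> R"
          using that[of i] m by (simp add: abs_mult)
        then show ?thesis by linarith
      qed
      then show ?thesis by (simp add: Q_def mem_box_cart)
    qed
    have "x \<in> Q"
    proof (rule inQ)
      fix i
      show "\<bar>real m * x $ i\<bar> \<le> real m * R"
        using z(2)[unfolded mem_grid_cell(2)[OF m], rule_format, of i] zi[of i] by linarith
    qed
    moreover have "c m z \<le> ennreal B"
      unfolding c_def cube_sup_def
    proof (rule SUP_least)
      fix u :: "real^'n" assume u: "u \<in> open_cube"
      have "(1 / real m) *\<^sub>R (z + u) \<in> Q"
      proof (rule inQ)
        fix i
        have "-1 < u $ i" "u $ i < 1" using u by (auto simp: open_cube_def)
        moreover have "real m * ((1 / real m) *\<^sub>R (z + u)) $ i = z $ i + u $ i" using m by simp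
        ultimately show "\<bar>real m * ((1 / real m) *\<^sub>R (z + u)) $ i\<bar> \<le> real m * R"
          using zi[of i] by linarith
      qed
      then show "ennreal (h ((1 / real m) *\<^sub>R (z + u))) \<le> ennreal B"
        by (intro ennreal_leI B)
    qed
    ultimately show ?thesis using z(3) by simp
  qed
  have "limsup (\<lambda>m. \<integral>\<^sup>+x. H m x \<partial>lebesgue) \<le> (\<integral>\<^sup>+x. limsup (\<lambda>m. H m x) \<partial>lebesgue)"
  proof (rule nn_integral_limsup)
    show "H m \<in> borel_measurable lebesgue" for m by (rule H_meas)
    show "(\<lambda>x. ennreal B * indicator Q x) \<in> borel_measurable lebesgue"
      unfolding Q_def by (intro borel_measurable_times_ennreal borel_measurable_indicator) auto
    show "AE x in lebesgue. H m x \<le> ennreal B * indicator Q x" for m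
      by (intro AE_I2 H_bound)
    have "emeasure lebesgue Q < \<infinity>" unfolding Q_def
      by (simp add: emeasure_lborel_cbox_eq)
    moreover have "Q \<in> sets lebesgue" unfolding Q_def by simp
    ultimately show "(\<integral>\<^sup>+x. ennreal B * indicator Q x \<partial>lebesgue) < \<infinity>"
      by (simp add: nn_integral_cmult_indicator ennreal_mult_less_top)
  qed
  also have "\<dots> \<le> (\<integral>\<^sup>+x. ennreal (h x) \<partial>lebesgue)"
  proof (rule nn_integral_mono)
    fix x :: "real^'n"
    show "limsup (\<lambda>m. H m x) \<le> ennreal (h x)"
      unfolding Limsup_le_iff
    proof (intro allI impI)
      fix y assume "ennreal (h x) < y"
      then obtain y' where y': "ennreal (h x) < y'" "y' < y" using dense by blast
      then obtain b where b: "y' = ennreal b" "0 \<le> b" by (cases y') auto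
      have "h x < b"
        using y' b by (metis ennreal_leI not_less)
      then have "eventually (\<lambda>w. h w < b) (nhds x)"
        using usc by (simp add: upper_semicontinuous_def)
      then obtain U where U: "open U" "x \<in> U" "\<And>w. w \<in> U \<Longrightarrow> h w < b"
        unfolding eventually_nhds by blast
      obtain d where d: "d > 0" "ball x d \<subseteq> U" using openE[OF U(1,2)] .
      \<comment> \<open>The bound \<open>2 / m\<close> on each coordinate gives \<open>2 * n / m\<close> for the norm in dimension \<open>n\<close>.\<close>
      have "(\<lambda>m. real CARD('n) * 2 / real m) \<longlonglongrightarrow> 0"
        by (rule lim_const_over_n)
      then have "eventually (\<lambda>m. real CARD('n) * 2 / real m < d) sequentially"
        using d(1) by (rule order_tendstoD)
      moreover have "eventually (\<lambda>m. 0 < m) sequentially" by (rule eventually_gt_at_top)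
      ultimately show "eventually (\<lambda>m. H m x < y) sequentially"
      proof eventually_elim
        case (elim m)
        show ?case
        proof (cases "H m x = 0")
          case True
          then show ?thesis using y' by (metis le_less_trans zero_le)
        next
          case False
          then obtain z where z: "z \<in> Z m" "x \<in> open_grid_cell m z" "H m x = c m z"
            using H_eq elim by blast
          have "c m z \<le> ennreal b"
            unfolding c_def cube_sup_def
          proof (rule SUP_least)
            fix u :: "real^'n" assume u: "u \<in> open_cube"
            let ?w = "(1 / real m) *\<^sub>R (z + u)"
            have "norm (?w - x) \<le> (\<Sum>i\<in>UNIV. \<bar>(?w - x) $ i\<bar>)" by (rule norm_le_l1_cart)
            also have "\<dots> \<le> (\<Sum>i\<in>(UNIV :: 'n set). 2 / real m)"
              using near_of_common_cell[OF elim(2) z(2) u] by (intro sum_mono) simp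
            also have "\<dots> < d" using elim(1) by simp
            finally have "?w \<in> U" using d(2) by (auto simp: dist_norm norm_minus_commute)
            then show "ennreal (h ?w) \<le> ennreal b"
              using U(3) by (intro ennreal_leI less_imp_le)
          qed
          then show ?thesis using z(3) y' b by simp
        qed
      qed
    qed
  qed
  finally show ?thesis unfolding H_int c_def .
qed

section \<open>Homogeneity and continuity of the power mean\<close>

lemma power_mean_scale:
  assumes "0 < r" "0 \<le> a" "0 \<le> b" "0 < l" "l < 1"
  shows "power_mean \<beta> l (r * a) (r * b) = r * power_mean \<beta> l a b"
proof (cases "a * b = 0")
  case True
  then show ?thesis by (auto simp: power_mean_def)
next
  case False
  then have ab: "0 < a" "0 < b" using assms by auto
  consider "\<beta> = \<infinity>" | "\<beta> = -\<infinity>" | "\<beta> = 0" | s where "\<beta> = ereal s" "s \<noteq> 0"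
    by (cases \<beta>) (auto simp: zero_ereal_def)
  then show ?thesis
  proof cases
    case 3
    have "r powr (1 - l) * r powr l = r"
      using assms by (simp flip: powr_add)
    then show ?thesis using 3 ab assms by (simp add: power_mean_def powr_mult mult_ac)
  next
    case 4
    have "(1 - l) * (r * a) powr s + l * (r * b) powr s
        = r powr s * ((1 - l) * a powr s + l * b powr s)"
      using assms by (simp add: powr_mult algebra_simps)
    moreover have "(r powr s) powr (1 / s) = r"
      using 4 assms by (simp add: powr_powr)
    ultimately show ?thesis using 4 ab assms
      by (simp add: power_mean_def powr_mult)
  qed (use ab assms in \<open>simp_all add: power_mean_def max_mult_distrib_left min_mult_distrib_left\<close>)
qed

text \<open>Positivity of the limits keeps the sequences away from the axes, where the mean is set to 0
  by convention and can be discontinuous.\<close>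

lemma power_mean_tendsto:
  assumes a: "(a \<longlongrightarrow> A) F" and b: "(b \<longlongrightarrow> B) F" and pos: "0 < A" "0 < B" and l: "0 < l" "l < 1"
  shows "((\<lambda>m. power_mean \<beta> l (a m) (b m)) \<longlongrightarrow> power_mean \<beta> l A B) F"
proof -
  have ev: "eventually (\<lambda>m. a m * b m \<noteq> 0) F"
    using order_tendstoD(1)[OF a pos(1)] order_tendstoD(1)[OF b pos(2)]
    by eventually_elim auto
  let ?M = "\<lambda>x y. if \<beta> = \<infinity> then max x y else if \<beta> = -\<infinity> then min x y
      else if \<beta> = 0 then x powr (1 - l) * y powr l
      else ((1 - l) * x powr real_of_ereal \<beta> + l * y powr real_of_ereal \<beta>) powr (1 / real_of_ereal \<beta>)"
  have nz: "(1 - l) * A powr s + l * B powr s \<noteq> 0" for s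
    using l pos by (smt (verit) mult_pos_pos powr_gt_zero)
  have "((\<lambda>m. ?M (a m) (b m)) \<longlongrightarrow> ?M A B) F"
    using pos nz by (auto intro!: tendsto_intros a b)
  moreover have "power_mean \<beta> l A B = ?M A B" using pos by (simp add: power_mean_def)
  moreover have "eventually (\<lambda>m. ?M (a m) (b m) = power_mean \<beta> l (a m) (b m)) F"
    using ev by eventually_elim (simp add: power_mean_def)
  ultimately show ?thesis using tendsto_cong by fastforce
qed

section \<open>Rescaling the hypothesis and bounding the p-combination\<close>

lemma p_mean_condition_rescale:
  fixes f g h :: "'a::real_vector \<Rightarrow> real"
  assumes "p_mean_condition l p \<alpha> UNIV UNIV f g h"
  shows "p_mean_condition l p \<alpha> K L (\<lambda>x. f (r *\<^sub>R x)) (\<lambda>x. g (r *\<^sub>R x)) (\<lambda>x. h (r *\<^sub>R x))"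
proof -
  have *: "r *\<^sub>R (t *\<^sub>R x + s *\<^sub>R y) = t *\<^sub>R (r *\<^sub>R x) + s *\<^sub>R (r *\<^sub>R y)"
    for t s and x y :: 'a
    by (simp add: scaleR_add_right mult.commute[of r])
  show ?thesis
    using assms unfolding p_mean_condition_def Let_def *
    by (cases "\<alpha> = 0"; simp only: if_True if_False simp_thms; blast)
qed

lemma holder_pow_bounds:
  assumes "1 \<le> p" "0 \<le> t" "t \<le> 1"
  shows "0 \<le> holder_pow p t" "holder_pow p t \<le> 1"
  using assms by (auto simp: holder_pow_def holder_conj_def powr_le1)

text \<open>Both coefficients in a p-combination are at most 1. The resulting bound is linear in the size of
  the sets, so a dilation by \<open>m\<close> of the sets at most dilates the bound by \<open>m\<close>.\<close>

lemma p_combination_component_bound: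
  fixes r :: real
  assumes p: "1 \<le> p" and l: "0 < l" "l < 1"
    and K: "\<And>x. x \<in> K \<Longrightarrow> \<bar>x $ i\<bar> \<le> r" and L: "\<And>y. y \<in> L \<Longrightarrow> \<bar>y $ i\<bar> \<le> r"
    and v: "v \<in> p_combination p l K L"
  shows "\<bar>v $ i\<bar> \<le> 2 * r"
proof -
  obtain x y t where xy: "x \<in> K" "y \<in> L" "0 \<le> t" "t \<le> 1" and
    v: "v = holder_pow p (1 - t) *\<^sub>R ((1 - l) powr (1 / p) *\<^sub>R x) +
            holder_pow p t *\<^sub>R (l powr (1 / p) *\<^sub>R y)"
    using v unfolding p_combination_def p_sum_def p_scale_def by blast
  have shrink: "\<bar>a * (b * w)\<bar> \<le> r" if "0 \<le> a" "a \<le> 1" "0 \<le> b" "b \<le> 1" "\<bar>w\<bar> \<le> r"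
    for a b w :: real
  proof -
    have "\<bar>a * (b * w)\<bar> = (a * b) * \<bar>w\<bar>"
      using that by (simp add: abs_mult mult.assoc)
    also have "\<dots> \<le> 1 * \<bar>w\<bar>" using that by (intro mult_right_mono mult_le_one) auto
    finally show ?thesis using that by simp
  qed
  have "\<bar>holder_pow p (1 - t) * ((1 - l) powr (1 / p) * x $ i)\<bar> \<le> r"
    using xy p l K by (intro shrink holder_pow_bounds) (auto simp: powr_le1)
  moreover have "\<bar>holder_pow p t * (l powr (1 / p) * y $ i)\<bar> \<le> r"
    using xy p l L by (intro shrink holder_pow_bounds) (auto simp: powr_le1)
  ultimately show ?thesis unfolding v by simp
qed

theorem theorem2p2:
  assumes discrete:
    "\<forall>l p. \<forall>(K :: (real^'n) set) (L :: (real^'n) set) \<alpha>. \<forall>f g h.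
       0 < l \<and> l < 1 \<and> 1 \<le> p \<and>
       K \<noteq> {} \<and> bounded K \<and> L \<noteq> {} \<and> bounded L \<and>
       ereal (- 1 / real CARD('n)) \<le> \<alpha> \<and>
       (\<forall>x. 0 \<le> f x) \<and> (\<forall>x. 0 \<le> g x) \<and> (\<forall>x. 0 \<le> h x) \<and>
       p_mean_condition l p \<alpha> K L f g h \<longrightarrow>
       (\<Sum>z\<in>(p_combination p l K L + open_cube) \<inter> int_lattice. cube_sup h z) \<ge>
         ennreal (power_mean (mean_index p CARD('n) \<alpha>) l
           (\<Sum>x\<in>K \<inter> int_lattice. f x) (\<Sum>y\<in>L \<inter> int_lattice. g y))"
  shows
    "\<forall>l p \<alpha>. \<forall>(f :: real^'n \<Rightarrow> real) (g :: real^'n \<Rightarrow> real) (h :: real^'n \<Rightarrow> real).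
       0 < l \<and> l < 1 \<and> 1 \<le> p \<and>
       ereal (- 1 / real CARD('n)) \<le> \<alpha> \<and>
       (\<forall>x. 0 \<le> f x) \<and> (\<forall>x. 0 \<le> g x) \<and> (\<forall>x. 0 \<le> h x) \<and>
       integrable lebesgue f \<and> integrable lebesgue g \<and> integrable lebesgue h \<and>
       riemann_integrable f \<and> riemann_integrable g \<and> upper_semicontinuous h \<and>
       p_mean_condition l p \<alpha> UNIV UNIV f g h \<longrightarrow>
       (\<integral>x. h x \<partial>lebesgue) \<ge>
         power_mean (mean_index p CARD('n) \<alpha>) l (\<integral>x. f x \<partial>lebesgue) (\<integral>y. g y \<partial>lebesgue)"
proof (intro allI impI)
  fix l p \<alpha> and f g h :: "real^'n \<Rightarrow> real"
  assume hyp: "0 < l \<and> l < 1 \<and> 1 \<le> p \<and>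
       ereal (- 1 / real CARD('n)) \<le> \<alpha> \<and>
       (\<forall>x. 0 \<le> f x) \<and> (\<forall>x. 0 \<le> g x) \<and> (\<forall>x. 0 \<le> h x) \<and>
       integrable lebesgue f \<and> integrable lebesgue g \<and> integrable lebesgue h \<and>
       riemann_integrable f \<and> riemann_integrable g \<and> upper_semicontinuous h \<and>
       p_mean_condition l p \<alpha> UNIV UNIV f g h"
  then have l: "0 < l" "l < 1" and p: "1 \<le> p" and \<alpha>: "ereal (- 1 / real CARD('n)) \<le> \<alpha>"
    and nn: "\<And>x. 0 \<le> f x" "\<And>x. 0 \<le> g x" "\<And>x. 0 \<le> h x"
    and int: "integrable lebesgue f" "integrable lebesgue g" "integrable lebesgue h"
    and R: "riemann_integrable f" "riemann_integrable g" and usc: "upper_semicontinuous h"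
    and cond: "p_mean_condition l p \<alpha> UNIV UNIV f g h"
    by auto
  define \<beta> where "\<beta> = mean_index p CARD('n) \<alpha>"
  define C :: "nat \<Rightarrow> (real^'n) set" where "C k = cbox (\<chi> i. - real k) (\<chi> i. real k)" for k
  let ?I = "\<lambda>\<phi> k. \<integral>x. indicator (C k) x * \<phi> x \<partial>lebesgue :: real"

  have on_cube: "power_mean \<beta> l (?I f k) (?I g k) \<le> (\<integral>x. h x \<partial>lebesgue)"
    if pos: "0 < k" "0 < ?I f k" "0 < ?I g k" for k
  proof -
    define K :: "nat \<Rightarrow> (real^'n) set" where "K m = half_open_cube (real m * real k)" for m
    define c where "c m = (1 / real m) ^ CARD('n)" for m
    define S where "S \<phi> m = (\<Sum>z\<in>K m \<inter> int_lattice. \<phi> ((1 / real m) *\<^sub>R z))"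
      for \<phi> :: "real^'n \<Rightarrow> real" and m
    define Z where "Z m = (p_combination p l (K m) (K m) + open_cube) \<inter> int_lattice" for m
    have K_bounded: "bounded (K m)" for m
      by (rule bounded_subset[OF bounded_cbox[of "\<chi> i. - (real m * real k)" "\<chi> i. real m * real k"]])
        (auto simp: K_def half_open_cube_def mem_box_cart less_imp_le)
    have sums: "ennreal (power_mean \<beta> l (c m * S f m) (c m * S g m))
        \<le> ennreal (c m) * (\<Sum>z\<in>Z m. cube_sup (\<lambda>x. h ((1 / real m) *\<^sub>R x)) z)"
      if m: "0 < m" for m
    proof -
      have "0 \<in> K m" using m pos(1) by (simp add: K_def half_open_cube_def)
      then have "K m \<noteq> {}" by blast
      then have D: "ennreal (power_mean \<beta> l (S f m) (S g m))
          \<le> (\<Sum>z\<in>Z m. cube_sup (\<lambda>x. h ((1 / real m) *\<^sub>R x)) z)"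
        unfolding \<beta>_def S_def Z_def
        by (intro discrete[rule_format] conjI allI p_mean_condition_rescale cond l p \<alpha> nn K_bounded)
      have "0 < c m" using m by (simp add: c_def)
      then have "power_mean \<beta> l (c m * S f m) (c m * S g m) = c m * power_mean \<beta> l (S f m) (S g m)"
        using l nn by (intro power_mean_scale) (auto simp: S_def intro: sum_nonneg)
      then show ?thesis
        using mult_left_mono[OF D, of "ennreal (c m)"] \<open>0 < c m\<close>
        by (simp add: ennreal_mult')
    qed
    have lim: "(\<lambda>m. c m * S \<phi> m) \<longlonglongrightarrow> ?I \<phi> k" if "riemann_integrable \<phi>" "integrable lebesgue \<phi>" for \<phi>
      unfolding c_def S_def K_def C_def using lattice_riemann_sums[OF that pos(1)] .
    have "(\<lambda>m. ennreal (power_mean \<beta> l (c m * S f m) (c m * S g m)))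
        \<longlonglongrightarrow> ennreal (power_mean \<beta> l (?I f k) (?I g k))"
      using R int pos l by (intro tendsto_ennrealI power_mean_tendsto lim)
    then have "ennreal (power_mean \<beta> l (?I f k) (?I g k))
        = limsup (\<lambda>m. ennreal (power_mean \<beta> l (c m * S f m) (c m * S g m)))"
      by (simp add: lim_imp_Limsup)
    also have "\<dots> \<le> limsup (\<lambda>m. ennreal (c m) * (\<Sum>z\<in>Z m. cube_sup (\<lambda>x. h ((1 / real m) *\<^sub>R x)) z))"
      by (intro Limsup_mono eventually_mono[OF eventually_gt_at_top[of 0]] sums)
    also have "\<dots> \<le> (\<integral>\<^sup>+x. ennreal (h x) \<partial>lebesgue)"
      unfolding c_def
      \<comment> \<open>Lattice points of the range have coordinates at most \<open>2 * m * k + 1\<close> in absolute value.\<close>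
    proof (rule limsup_lattice_sums_le_integral[OF usc, where R = "2 * real k + 2"])
      show "Z m \<subseteq> int_lattice" for m by (simp add: Z_def)
      show "finite (Z m)" for m
        unfolding Z_def
        by (intro finite_int_lattice_Int bounded_p_combination_open_cube p l K_bounded)
      fix m z i assume m: "0 < m" and "z \<in> Z m"
      then obtain v u where z: "z = v + u" "v \<in> p_combination p l (K m) (K m)" "u \<in> open_cube"
        by (auto simp: Z_def elim: set_plus_elim)
      have "\<bar>x $ i\<bar> \<le> real m * real k" if "x \<in> K m" for x
        using that by (auto simp: K_def half_open_cube_def abs_le_iff minus_le_iff less_imp_le)
      then have "\<bar>v $ i\<bar> \<le> 2 * (real m * real k)"
        using p_combination_component_bound[OF p l _ _ z(2)] by blast
      moreover have "-1 < u $ i" "u $ i < 1" using z(3) by (auto simp: open_cube_def)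
      ultimately have "\<bar>z $ i\<bar> \<le> 2 * (real m * real k) + 1" unfolding z(1) by simp
      moreover have "1 \<le> real m" using m by simp
      ultimately show "\<bar>z $ i\<bar> \<le> real m * (2 * real k + 2) - 1"
        unfolding distrib_left by linarith
    qed
    also have "\<dots> = ennreal (\<integral>x. h x \<partial>lebesgue)"
      using int nn by (intro nn_integral_eq_integral) auto
    finally show ?thesis
      using nn by (simp add: ennreal_le_iff integral_nonneg_AE)
  qed

  have nnI: "0 \<le> (\<integral>x. f x \<partial>lebesgue)" "0 \<le> (\<integral>x. g x \<partial>lebesgue)" "0 \<le> (\<integral>x. h x \<partial>lebesgue)"
    using nn by (simp_all add: integral_nonneg_AE)
  show "power_mean (mean_index p CARD('n) \<alpha>) l (\<integral>x. f x \<partial>lebesgue) (\<integral>y. g y \<partial>lebesgue)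
      \<le> (\<integral>x. h x \<partial>lebesgue)"
  proof (cases "(\<integral>x. f x \<partial>lebesgue) * (\<integral>y. g y \<partial>lebesgue) = 0")
    case True
    then show ?thesis using nnI by (simp add: power_mean_def)
  next
    case False
    then have pos: "0 < (\<integral>x. f x \<partial>lebesgue)" "0 < (\<integral>x. g x \<partial>lebesgue)" using nnI by auto
    have lims: "?I f \<longlonglongrightarrow> (\<integral>x. f x \<partial>lebesgue)" "?I g \<longlonglongrightarrow> (\<integral>x. g x \<partial>lebesgue)"
      unfolding C_def by (intro integral_cubes_tendsto int)+
    have "(\<lambda>k. power_mean \<beta> l (?I f k) (?I g k))
        \<longlonglongrightarrow> power_mean \<beta> l (\<integral>x. f x \<partial>lebesgue) (\<integral>x. g x \<partial>lebesgue)"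
      using pos l by (intro power_mean_tendsto lims)
    moreover have "eventually (\<lambda>k. power_mean \<beta> l (?I f k) (?I g k) \<le> (\<integral>x. h x \<partial>lebesgue)) sequentially"
      using order_tendstoD(1)[OF lims(1) pos(1)] order_tendstoD(1)[OF lims(2) pos(2)]
        eventually_gt_at_top[of "0 :: nat"]
      by eventually_elim (rule on_cube)
    ultimately show ?thesis
      unfolding \<beta>_def by (intro tendsto_upperbound[where F = sequentially]) auto
  qed
qed

end
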